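(* Let $s\in\mathbb R$, $h\in\mathbb C\setminus\{0\}$ and $q>0$ real, and let $S_{s,h,q}[n,k]$ be defined through rook placements under the pre-weight rule (see context), with $B_{s,h,q}[n]=\sum_{k=0}^nS_{s,h,q}[n,k]$. Then for all integers $n,k\ge1$, $$S_{s,h,q}[n,k]=\sum_{r=k-1}^{n-1}h^{n-r-1}q^r\genfrac{[}{]}{0pt}{}{n-1}{r}_{q^s}S_{s,h,q}[r,k-1]\prod_{i=0}^{n-r-2}[1+si]_q ,$$ $$B_{s,h,q}[n]=\sum_{r=0}^{n-1}h^{n-r-1}q^r\genfrac{[}{]}{0pt}{}{n-1}{r}_{q^s}B_{s,h,q}[r]\prod_{i=0}^{n-r-2}[1+si]_q ,$$ and for all nonnegative integers $n,m,k$, $$S_{s,h,q}[n+m,k]=\sum_{r=0}^n\sum_{j=0}^mh^{n-r}q^{r(j(1-s)+sm)}\genfrac{[}{]}{0pt}{}{n}{r}_{q^s}S_{s,h,q}[m,j]\,S_{s,h,q}[r,k-j]\prod_{i=0}^{n-r-1}[j(1-s)+sm+si]_q ,$$ $$B_{s,h,q}[n+m]=\sum_{r=0}^n\sum_{j=0}^mh^{n-r}q^{r(j(1-s)+sm)}\genfrac{[}{]}{0pt}{}{n}{r}_{q^s}S_{s,h,q}[m,j]\,B_{s,h,q}[r]\prod_{i=0}^{n-r-1}[j(1-s)+sm+si]_q .$$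
   Context: For $x\in\mathbb R$, $[x]_q=\frac{q^x-1}{q-1}$ if $q\ne1$ and $[x]_1=x$. $\genfrac{[}{]}{0pt}{}{n}{k}_p$ is the Gaussian ($p$-binomial) coefficient, understood as a polynomial in $p$ evaluated at the given value. Let $J_n$ be the Ferrers board outlined by the word $(VU)^n$ ($U$ a horizontal step, $V$ a vertical step): it has $n$ columns and, numbering columns from right to left, column $i$ has $i-1$ cells; the columns are aligned at the top, so that each cell of column $i$ has cells to its left in the same row in all columns $i'>i$. Pre-weight rule: rooks are placed on cells in some chosen columns from right to left, at most one rook per column. Every cell has default pre-weight $1$, and each rook adds $s-1$ to the pre-weight of every cell to its left in its row. Every cell lying above a rook in the same column has weight $1$. A cell not lying above a rook and having pre-weight $p$ has weight $h[p]_q$ if it contains a rook and $q^p$ otherwise. The weight $\omega(\psi)$ of a placement $\psi$ is the product of the weights of all cells. $C^*_k(J_n;s)$ is the set of placements of $k$ rooks on $J_n$ under this rule. For $s\in\mathbb R$, $S_{s,h,q}[n,k]=\sum_{\psi\in C^*_{n-k}(J_n;s)}\omega(\psi)$ for $0\le k\le n$, and $S_{s,h,q}[n,k]=0$ for $k<0$ or $k>n$. (For $s$ a nonnegative integer these are the normal ordering coefficients of $(VU)^n$ when $UV-qVU=hV^s$.) Empty products equal $1$, empty sums equal $0$. *)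

theory Defs
  imports Complex_Main "HOL-Computational_Algebra.Polynomial"
begin

definition q_num :: "real \<Rightarrow> real \<Rightarrow> real" where
  "q_num q x = (if q = 1 then x else (q powr x - 1) / (q - 1))"

definition q_fact_poly :: "nat \<Rightarrow> real poly" where
  "q_fact_poly n = (\<Prod>i = 1..n. \<Sum>j<i. monom 1 j)"

(* The division is exact (see gauss_binom_poly_mult). Since it takes place in the
   polynomial ring, evaluation is meaningful at every p, roots of the denominator included. *)
definition gauss_binom_poly :: "nat \<Rightarrow> nat \<Rightarrow> real poly" where
  "gauss_binom_poly n k =
     (if k \<le> n then q_fact_poly n div (q_fact_poly k * q_fact_poly (n - k)) else 0)"

definition gauss_binom :: "real \<Rightarrow> nat \<Rightarrow> nat \<Rightarrow> real" where
  "gauss_binom p n k = poly (gauss_binom_poly n k) p"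

lemma q_fact_poly_nonzero: "q_fact_poly n \<noteq> 0"
proof -
  have "poly (q_fact_poly n) 1 = (\<Prod>i = 1..n. real i)"
    by (simp add: q_fact_poly_def poly_prod poly_sum poly_monom)
  also have "\<dots> \<noteq> 0"
    by simp
  finally show ?thesis
    by auto
qed

lemma q_fact_poly_Suc:
  "q_fact_poly (Suc n) = (\<Sum>j<Suc n. monom 1 j) * q_fact_poly n"
  by (simp add: q_fact_poly_def prod.nat_ivl_Suc' mult.commute)

lemma q_fact_poly_dvd:
  "q_fact_poly a * q_fact_poly b dvd q_fact_poly (a + b)"
proof (induction "a + b" arbitrary: a b)
  case 0
  then show ?case by (simp add: q_fact_poly_def)
next
  case (Suc n)
  show ?case
  proof (cases "a = 0 \<or> b = 0")
    case True
    then show ?thesis by (auto simp: q_fact_poly_def)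
  next
    case False
    then obtain a' b' where ab: "a = Suc a'" "b = Suc b'"
      by (meson not0_implies_Suc)
    have n: "n = a' + b" "n = a + b'" using Suc.hyps(2) ab by auto
    have sum_split: "(\<Sum>j<a + b. monom (1::real) j) =
        (\<Sum>j<a. monom 1 j) + monom 1 a * (\<Sum>j<b. monom 1 j)"
      by (induction b) (simp_all add: mult_monom algebra_simps)
    have *: "q_fact_poly a * q_fact_poly b dvd (\<Sum>j<a. monom 1 j) * q_fact_poly n"
      using Suc.hyps(1)[OF n(1)] n(1) ab
      by (simp only: q_fact_poly_Suc[of a'] mult.assoc) (auto intro: mult_dvd_mono)
    have "q_fact_poly b * q_fact_poly a dvd (\<Sum>j<b. monom 1 j) * q_fact_poly n"
      using Suc.hyps(1)[OF n(2)] n(2) ab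
      by (simp only: q_fact_poly_Suc[of b'] mult.assoc)
        (auto intro: mult_dvd_mono simp: mult.commute)
    then have "q_fact_poly a * q_fact_poly b dvd
        monom 1 a * ((\<Sum>j<b. monom 1 j) * q_fact_poly n)"
      by (metis dvd_mult mult.commute)
    with * have "q_fact_poly a * q_fact_poly b dvd (\<Sum>j<a + b. monom 1 j) * q_fact_poly n"
      unfolding sum_split by (simp only: distrib_right mult.assoc) (rule dvd_add)
    then show ?thesis
      using Suc.hyps(2) q_fact_poly_Suc[of n] by metis
  qed
qed

lemma gauss_binom_poly_mult:
  assumes "k \<le> n"
  shows "gauss_binom_poly n k * (q_fact_poly k * q_fact_poly (n - k)) = q_fact_poly n"
  using q_fact_poly_dvd[of k "n - k"] assms
  by (simp add: gauss_binom_poly_def)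

(* A cell is a pair (i, r): i is the column, counted from 1 from right to left, and r the row,
   counted from 1 from top to bottom. Columns being aligned at the top, column i consists of
   the rows 1, ..., i - 1. *)
definition J_board :: "nat \<Rightarrow> (nat \<times> nat) set" where
  "J_board n = {(i, r). 1 \<le> i \<and> i \<le> n \<and> 1 \<le> r \<and> r \<le> i - 1}"

(* Two rooks may share a row. *)
definition placements :: "nat \<Rightarrow> nat \<Rightarrow> (nat \<times> nat) set set" where
  "placements k n =
     {\<psi>. \<psi> \<subseteq> J_board n \<and> card \<psi> = k \<and> (\<forall>i r r'. (i, r) \<in> \<psi> \<and> (i, r') \<in> \<psi> \<longrightarrow> r = r')}"

(* The rooks contributing to the pre-weight of a cell are those to its right in its row,
   i.e. those with a smaller column number. *)
definition pre_weight :: "real \<Rightarrow> (nat \<times> nat) set \<Rightarrow> nat \<times> nat \<Rightarrow> real" where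
  "pre_weight s \<psi> = (\<lambda>(i, r). 1 + (s - 1) * real (card {i'. i' < i \<and> (i', r) \<in> \<psi>}))"

definition cell_weight ::
  "real \<Rightarrow> complex \<Rightarrow> real \<Rightarrow> (nat \<times> nat) set \<Rightarrow> nat \<times> nat \<Rightarrow> complex" where
  "cell_weight s h q \<psi> = (\<lambda>(i, r).
     if \<exists>r'>r. (i, r') \<in> \<psi> then 1
     else if (i, r) \<in> \<psi> then h * of_real (q_num q (pre_weight s \<psi> (i, r)))
     else of_real (q powr pre_weight s \<psi> (i, r)))"

definition placement_weight ::
  "real \<Rightarrow> complex \<Rightarrow> real \<Rightarrow> nat \<Rightarrow> (nat \<times> nat) set \<Rightarrow> complex" where
  "placement_weight s h q n \<psi> = (\<Prod>c\<in>J_board n. cell_weight s h q \<psi> c)"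

definition S_coeff :: "real \<Rightarrow> complex \<Rightarrow> real \<Rightarrow> nat \<Rightarrow> int \<Rightarrow> complex" where
  "S_coeff s h q n k =
     (if 0 \<le> k \<and> k \<le> int n
      then \<Sum>\<psi>\<in>placements (n - nat k) n. placement_weight s h q n \<psi>
      else 0)"

definition B_coeff :: "real \<Rightarrow> complex \<Rightarrow> real \<Rightarrow> nat \<Rightarrow> complex" where
  "B_coeff s h q n = (\<Sum>k = 0..n. S_coeff s h q n (int k))"

end

(* Filling the last column: by [a + b] = [a] + q^a [b], the sum over all positions of a rook in a
   column telescopes to h [P]_q, where P is the total pre-weight of the column, while an empty column
   contributes q^P. As P depends only on n and the number of earlier rooks,
     S[n+1,k] = q^(sn + (k-1)(1-s)) S[n,k-1] + h [sn + k(1-s)]_q S[n,k].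
   Started from S[m,j] instead of S[0,0], the same recursion runs with all exponents shifted by
   x = j(1-s) + sm. Splitting x + sn + l(1-s) = (x + s(n-r)) + (sr + l(1-s)) shows that the shifted
   recursion is solved by sum_r c(n,r) S[r,l], where c(n,r) is the coefficient in the convolution;
   the recursion for c(n,r) is the Pascal rule for Gaussian coefficients at q^s. The first two
   identities are the case m = 1, and those for B follow by summing over k. *)

theory Submission
  imports Defs
begin

section \<open>The column recurrence\<close>

lemma q_num_add:
  assumes "q > 0"
  shows "q_num q (a + b) = q_num q a + q powr a * q_num q b"
proof (cases "q = 1")
  case False
  then show ?thesis
    by (simp add: q_num_def powr_add divide_simps) (simp add: algebra_simps)
qed (simp add: q_num_def)

lemma q_num_0: "q > 0 \<Longrightarrow> q_num q 0 = 0"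
  by (simp add: q_num_def)

text \<open>Appending row \<open>n + 1\<close> at the bottom multiplies every earlier summand by
  \<open>q powr p (Suc n)\<close> and adds \<open>q_num q (p (Suc n))\<close>, which is one
  application of \<open>q_num_add\<close>. The product runs over \<open>j > r\<close> because only
  the cells below a rook keep their weight.\<close>

lemma q_num_sum:
  fixes p :: "nat \<Rightarrow> real"
  assumes "q > 0"
  shows "(\<Sum>r=1..n. q_num q (p r) * (\<Prod>j\<in>{r<..n}. q powr p j)) = q_num q (\<Sum>r=1..n. p r)"
proof (induction n)
  case 0
  then show ?case using assms by (simp add: q_num_0)
next
  case (Suc n)
  have "(\<Prod>j\<in>{r<..Suc n}. q powr p j) = q powr p (Suc n) * (\<Prod>j\<in>{r<..n}. q powr p j)"
    if "r \<in> {1..n}" for r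
  proof -
    have "{r<..Suc n} = insert (Suc n) {r<..n}" using that by auto
    then show ?thesis by simp
  qed
  then have "(\<Sum>r=1..n. q_num q (p r) * (\<Prod>j\<in>{r<..Suc n}. q powr p j)) =
      q powr p (Suc n) * (\<Sum>r=1..n. q_num q (p r) * (\<Prod>j\<in>{r<..n}. q powr p j))"
    unfolding sum_distrib_left by (intro sum.cong) auto
  then show ?case
    using Suc.IH q_num_add[OF assms, of "p (Suc n)" "\<Sum>r=1..n. p r"]
    by (simp add: add.commute)
qed

section \<open>Weights and pre-weights in the last column\<close>

lemma finite_J_board: "finite (J_board n)"
  by (rule finite_subset[of _ "{1..n} \<times> {1..n}"]) (auto simp: J_board_def)

lemma finite_placements: "finite (placements k n)"
  by (rule finite_subset[of _ "Pow (J_board n)"])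
    (auto simp: placements_def finite_J_board)

lemma placementsD:
  assumes "\<psi> \<in> placements k n"
  shows "\<psi> \<subseteq> J_board n" "finite \<psi>" "card \<psi> = k" "(Suc n, r) \<notin> \<psi>"
proof -
  show sub: "\<psi> \<subseteq> J_board n" and "card \<psi> = k"
    using assms by (simp_all add: placements_def)
  then show "finite \<psi>" "(Suc n, r) \<notin> \<psi>"
    using finite_subset[OF sub finite_J_board] by (auto simp: J_board_def)
qed

lemma J_board_0: "J_board 0 = {}"
  by (auto simp: J_board_def)

lemma J_board_Suc: "J_board (Suc n) = J_board n \<union> Pair (Suc n) ` {1..n}"
  by (auto simp: J_board_def)

lemma placement_weight_Suc:
  "placement_weight s h q (Suc n) \<psi> =
     placement_weight s h q n \<psi> * (\<Prod>r=1..n. cell_weight s h q \<psi> (Suc n, r))"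
proof -
  have "J_board n \<inter> Pair (Suc n) ` {1..n} = {}"
    by (auto simp: J_board_def)
  then show ?thesis
    unfolding placement_weight_def J_board_Suc
    by (subst prod.union_disjoint) (auto simp: finite_J_board prod.reindex inj_on_def)
qed

text \<open>Only rooks in strictly smaller columns count, so a rook in column \<open>n\<close>
  changes nothing in columns up to and including \<open>n\<close>.\<close>

lemma pre_weight_insert:
  assumes "i \<le> n"
  shows "pre_weight s (insert (n, r0) \<psi>) (i, r) = pre_weight s \<psi> (i, r)"
proof -
  have "{i'. i' < i \<and> (i', r) \<in> insert (n, r0) \<psi>} = {i'. i' < i \<and> (i', r) \<in> \<psi>}"
    using assms by auto
  then show ?thesis by (simp add: pre_weight_def)
qed

lemma placement_weight_insert:
  "placement_weight s h q n (insert (Suc n, r0) \<psi>) = placement_weight s h q n \<psi>"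
  unfolding placement_weight_def
proof (rule prod.cong)
  fix c assume "c \<in> J_board n"
  then obtain i r where "c = (i, r)" "i \<le> n" by (auto simp: J_board_def)
  then show "cell_weight s h q (insert (Suc n, r0) \<psi>) c = cell_weight s h q \<psi> c"
    by (auto simp: cell_weight_def pre_weight_insert)
qed simp

text \<open>Each of the \<open>k\<close> rooks has exactly one cell of the new column in its row and
  raises the pre-weight of that cell by \<open>s - 1\<close>. The total is therefore independent of
  where the rooks stand.\<close>

lemma sum_pre_weight:
  assumes "\<psi> \<in> placements k n"
  shows "(\<Sum>r=1..n. pre_weight s \<psi> (Suc n, r)) = real n + (s - 1) * real k"
proof -
  have fin: "finite {i'. i' < Suc n \<and> (i', r) \<in> \<psi>}" for r
    by simp
  \<comment> \<open>Partition of the rooks by rows, so that the row counts add up to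
    \<open>k\<close>.\<close>
  have "\<psi> = (\<Union>r\<in>{1..n}. (\<lambda>i. (i, r)) ` {i'. i' < Suc n \<and> (i', r) \<in> \<psi>})"
    using placementsD(1)[OF assms] by (fastforce simp: J_board_def)
  then have "card \<psi> = card (\<Union>r\<in>{1..n}. (\<lambda>i. (i, r)) ` {i'. i' < Suc n \<and> (i', r) \<in> \<psi>})"
    by simp
  also have "\<dots> = (\<Sum>r=1..n. card ((\<lambda>i. (i, r)) ` {i'. i' < Suc n \<and> (i', r) \<in> \<psi>}))"
    using fin by (intro card_UN_disjoint) auto
  also have "\<dots> = (\<Sum>r=1..n. card {i'. i' < Suc n \<and> (i', r) \<in> \<psi>})"
    by (intro sum.cong card_image) (auto simp: inj_on_def)
  finally have "real k = (\<Sum>r=1..n. real (card {i'. i' < Suc n \<and> (i', r) \<in> \<psi>}))"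
    using placementsD(3)[OF assms] by simp
  then show ?thesis
    by (simp add: pre_weight_def sum.distrib flip: sum_distrib_left)
qed

lemma column_weight_empty:
  assumes "\<psi> \<in> placements k n" "q > 0"
  shows "(\<Prod>r=1..n. cell_weight s h q \<psi> (Suc n, r)) =
           of_real (q powr (real n + (s - 1) * real k))"
proof -
  have "(\<Prod>r=1..n. cell_weight s h q \<psi> (Suc n, r)) =
      (\<Prod>r=1..n. of_real (q powr pre_weight s \<psi> (Suc n, r)))"
    using placementsD(4)[OF assms(1)] by (simp add: cell_weight_def)
  also have "\<dots> = of_real (q powr (\<Sum>r=1..n. pre_weight s \<psi> (Suc n, r)))"
    using assms(2) by (simp add: powr_sum)
  finally show ?thesis by (simp only: sum_pre_weight[OF assms(1)])
qed

text \<open>The rows above \<open>r0\<close> contribute 1 and those below it powers of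
  \<open>q\<close>; up to the factor \<open>h\<close> this is the summand for \<open>r0\<close> in
  \<open>q_num_sum\<close>.\<close>

lemma column_weight_rook:
  assumes "\<psi> \<in> placements k n" "r0 \<in> {1..n}"
  shows "(\<Prod>r=1..n. cell_weight s h q (insert (Suc n, r0) \<psi>) (Suc n, r)) =
           h * of_real (q_num q (pre_weight s \<psi> (Suc n, r0)) *
             (\<Prod>r\<in>{r0<..n}. q powr pre_weight s \<psi> (Suc n, r)))"
proof -
  let ?w = "\<lambda>r. cell_weight s h q (insert (Suc n, r0) \<psi>) (Suc n, r)"
  have "{1..n} = {1..<r0} \<union> {r0} \<union> {r0<..n}" using assms(2) by auto
  then have "prod ?w {1..n} = prod ?w {1..<r0} * ?w r0 * prod ?w {r0<..n}"
    by (simp only:) (subst prod.union_disjoint; force simp: mult.commute)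
  moreover have "prod ?w {1..<r0} = 1"
    by (rule prod.neutral) (auto simp: cell_weight_def)
  moreover have "?w r0 = h * of_real (q_num q (pre_weight s \<psi> (Suc n, r0)))"
    using placementsD(4)[OF assms(1)] by (auto simp: cell_weight_def pre_weight_insert)
  moreover have "prod ?w {r0<..n} = of_real (\<Prod>r\<in>{r0<..n}. q powr pre_weight s \<psi> (Suc n, r))"
    unfolding of_real_prod using placementsD(4)[OF assms(1)]
    by (intro prod.cong) (auto simp: cell_weight_def pre_weight_insert)
  ultimately show ?thesis by simp
qed

section \<open>Recurrence in the number of columns and of rooks\<close>

definition rook_sum :: "real \<Rightarrow> complex \<Rightarrow> real \<Rightarrow> nat \<Rightarrow> nat \<Rightarrow> complex" where
  "rook_sum s h q n k = (\<Sum>\<psi>\<in>placements k n. placement_weight s h q n \<psi>)"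

lemma placements_subset_Suc: "placements k n \<subseteq> placements k (Suc n)"
  by (auto simp: placements_def J_board_Suc)

text \<open>Either the last column is empty, or its unique rook can be removed, leaving a placement
  on the smaller board.\<close>

lemma placements_Suc_cases:
  assumes "\<psi> \<in> placements k (Suc n)"
  shows "\<psi> \<in> placements k n \<or>
    (\<exists>\<psi>' r0 k'. k = Suc k' \<and> r0 \<in> {1..n} \<and> \<psi>' \<in> placements k' n \<and> \<psi> = insert (Suc n, r0) \<psi>')"
proof (cases "\<exists>r0. (Suc n, r0) \<in> \<psi>")
  case True
  then obtain r0 where r0: "(Suc n, r0) \<in> \<psi>" by blast
  let ?\<phi> = "\<psi> - {(Suc n, r0)}"
  have fin: "finite \<psi>" and sub: "\<psi> \<subseteq> J_board (Suc n)" and k: "card \<psi> = k"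
    using placementsD[OF assms] by auto
  have uniq: "r = r'" if "(i, r) \<in> \<psi>" "(i, r') \<in> \<psi>" for i r r'
    using assms that unfolding placements_def by blast
  have "card \<psi> = Suc (card ?\<phi>)"
    using fin r0 by (metis card_Suc_Diff1)
  moreover have "?\<phi> \<subseteq> J_board n"
    using sub uniq[OF r0] by (auto simp: J_board_Suc)
  then have "?\<phi> \<in> placements (card ?\<phi>) n"
    using uniq by (simp add: placements_def) metis
  moreover have "\<psi> = insert (Suc n, r0) ?\<phi>" "r0 \<in> {1..n}"
    using r0 sub by (auto simp: J_board_def)
  ultimately show ?thesis
    using k by metis
next
  case False
  then have "\<psi> \<subseteq> J_board n"
    using placementsD(1)[OF assms] by (auto simp: J_board_Suc)
  then show ?thesis
    using assms by (simp add: placements_def)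
qed

lemma insert_placement:
  assumes "\<psi> \<in> placements k n" "r0 \<in> {1..n}"
  shows "insert (Suc n, r0) \<psi> \<in> placements (Suc k) (Suc n)"
proof -
  have "insert (Suc n, r0) \<psi> \<subseteq> J_board (Suc n)"
    using placementsD(1)[OF assms(1)] assms(2) unfolding J_board_Suc by blast
  moreover have "card (insert (Suc n, r0) \<psi>) = Suc k"
    using placementsD[OF assms(1)] by simp
  moreover have "r = r'"
    if "(i, r) \<in> insert (Suc n, r0) \<psi>" "(i, r') \<in> insert (Suc n, r0) \<psi>" for i r r'
  proof (cases "i = Suc n")
    case True
    then show ?thesis using that placementsD(4)[OF assms(1)] by simp
  next
    case False
    then have "(i, r) \<in> \<psi>" "(i, r') \<in> \<psi>" using that by auto
    then show ?thesis using assms(1) unfolding placements_def by blast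
  qed
  ultimately show ?thesis
    unfolding placements_def by blast
qed

lemma rook_sum_Suc_0:
  assumes "q > 0"
  shows "rook_sum s h q (Suc n) 0 = of_real (q powr real n) * rook_sum s h q n 0"
proof -
  have "placements 0 (Suc n) = placements 0 n"
    \<comment> \<open>A rook in the last column would force \<open>0 = Suc k'\<close>.\<close>
    using placements_subset_Suc placements_Suc_cases by blast
  then show ?thesis
    using column_weight_empty[of _ 0 n, OF _ assms]
    by (simp add: rook_sum_def placement_weight_Suc sum_distrib_left mult.commute)
qed

text \<open>The first term collects the placements with empty last column, all \<open>k + 1\<close>
  rooks standing earlier. The second collects those with a rook there, preceded by only
  \<open>k\<close> rooks.\<close>

lemma rook_sum_Suc_Suc:
  assumes "q > 0"
  shows "rook_sum s h q (Suc n) (Suc k) =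
    of_real (q powr (real n + (s - 1) * real (Suc k))) * rook_sum s h q n (Suc k) +
    h * of_real (q_num q (real n + (s - 1) * real k)) * rook_sum s h q n k"
proof -
  \<comment> \<open>The placements with a rook in the last column, parametrised injectively by the
    remaining rooks and the row of that rook.\<close>
  define I where "I = (\<lambda>(\<psi>, r0). insert (Suc n, r0) \<psi>) ` (placements k n \<times> {1..n})"
  have inj: "inj_on (\<lambda>(\<psi>, r0). insert (Suc n, r0) \<psi>) (placements k n \<times> {1..n})"
  proof (rule inj_onI, clarify)
    fix \<psi> r \<psi>' r'
    assume *: "\<psi> \<in> placements k n" "\<psi>' \<in> placements k n"
      "insert (Suc n, r) \<psi> = insert (Suc n, r') \<psi>'"
    have "r = r'" using *(3) placementsD(4)[OF *(2)] by blast
    then show "\<psi> = \<psi>' \<and> r = r'"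
      using *(3) placementsD(4)[OF *(1)] placementsD(4)[OF *(2)] by (metis insert_ident)
  qed
  have split: "placements (Suc k) (Suc n) = placements (Suc k) n \<union> I"
    using placements_subset_Suc placements_Suc_cases insert_placement
    by (fastforce simp: I_def)
  have disj: "placements (Suc k) n \<inter> I = {}"
    using placementsD(4) by (fastforce simp: I_def)
  have "(\<Sum>\<psi>\<in>placements (Suc k) n. placement_weight s h q (Suc n) \<psi>) =
      of_real (q powr (real n + (s - 1) * real (Suc k))) * rook_sum s h q n (Suc k)"
    unfolding rook_sum_def sum_distrib_left
    by (intro sum.cong refl)
      (simp only: placement_weight_Suc column_weight_empty[OF _ assms] mult.commute)
  moreover have "(\<Sum>\<psi>\<in>I. placement_weight s h q (Suc n) \<psi>) =
      h * of_real (q_num q (real n + (s - 1) * real k)) * rook_sum s h q n k"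
  proof -
    have "(\<Sum>\<psi>\<in>I. placement_weight s h q (Suc n) \<psi>) =
        (\<Sum>\<psi>\<in>placements k n. \<Sum>r0=1..n. placement_weight s h q (Suc n) (insert (Suc n, r0) \<psi>))"
      unfolding I_def sum.reindex[OF inj] sum.cartesian_product by (simp add: case_prod_unfold)
    also have "\<dots> = (\<Sum>\<psi>\<in>placements k n. placement_weight s h q n \<psi> *
        (h * of_real (q_num q (real n + (s - 1) * real k))))"
    proof (rule sum.cong)
      fix \<psi> assume \<psi>: "\<psi> \<in> placements k n"
      let ?p = "\<lambda>r. pre_weight s \<psi> (Suc n, r)"
      have "(\<Sum>r0=1..n. placement_weight s h q (Suc n) (insert (Suc n, r0) \<psi>)) =
          (\<Sum>r0=1..n. placement_weight s h q n \<psi> *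
            (h * of_real (q_num q (?p r0) * (\<Prod>r\<in>{r0<..n}. q powr ?p r))))"
        using column_weight_rook[OF \<psi>]
        by (intro sum.cong) (auto simp: placement_weight_Suc placement_weight_insert)
      also have "\<dots> = placement_weight s h q n \<psi> *
          (h * of_real (\<Sum>r0=1..n. q_num q (?p r0) * (\<Prod>r\<in>{r0<..n}. q powr ?p r)))"
        unfolding of_real_sum sum_distrib_left ..
      also have "\<dots> = placement_weight s h q n \<psi> * (h * of_real (q_num q (real n + (s - 1) * real k)))"
        by (simp only: q_num_sum[OF assms] sum_pre_weight[OF \<psi>])
      finally show "(\<Sum>r0=1..n. placement_weight s h q (Suc n) (insert (Suc n, r0) \<psi>)) =
          placement_weight s h q n \<psi> * (h * of_real (q_num q (real n + (s - 1) * real k)))" .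
    qed simp
    finally show ?thesis
      unfolding rook_sum_def sum_distrib_right[symmetric] by (simp only: mult.commute)
  qed
  moreover have "finite (placements (Suc k) n)" "finite I"
    using finite_placements[of "Suc k" "Suc n"] unfolding split by auto
  ultimately show ?thesis
    unfolding rook_sum_def[of s h q "Suc n"] split
    by (subst sum.union_disjoint) (use disj in auto)
qed

lemma rook_sum_0_left: "rook_sum s h q 0 k = (if k = 0 then 1 else 0)"
proof -
  have "placements k 0 = (if k = 0 then {{}} else {})"
    by (auto simp: placements_def J_board_0)
  then show ?thesis
    by (simp add: rook_sum_def placement_weight_def J_board_0)
qed

text \<open>The bound of one rook per column, read off from the recurrence; it settles the boundary
  index 0 in \<open>S_coeff_Suc\<close>.\<close>

lemma rook_sum_eq_0:
  assumes "q > 0"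
  shows "n < k \<Longrightarrow> rook_sum s h q n k = 0"
proof (induction n arbitrary: k)
  case 0
  then show ?case by (simp add: rook_sum_0_left)
next
  case (Suc n)
  then obtain k' where "k = Suc k'" by (cases k) auto
  then show ?case using Suc by (simp add: rook_sum_Suc_Suc[OF assms])
qed

lemma S_coeff_rook_sum:
  "S_coeff s h q n k = (if 0 \<le> k \<and> k \<le> int n then rook_sum s h q n (n - nat k) else 0)"
  by (simp add: S_coeff_def rook_sum_def)

lemma S_coeff_0_left: "S_coeff s h q 0 k = (if k = 0 then 1 else 0)"
  by (simp add: S_coeff_rook_sum rook_sum_0_left)

lemma S_coeff_out_of_range: "k < 0 \<or> k > int n \<Longrightarrow> S_coeff s h q n k = 0"
  by (auto simp: S_coeff_def)

text \<open>With \<open>n - k\<close> rooks the column total \<open>n + (s - 1)(n - k)\<close>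
  equals \<open>s n + k (1 - s)\<close>. Admitting every integer \<open>k\<close> lets the
  convolution shift the index without side conditions.\<close>

lemma S_coeff_Suc:
  assumes "q > 0"
  shows "S_coeff s h q (Suc n) k =
    of_real (q powr (s * real n + of_int (k - 1) * (1 - s))) * S_coeff s h q n (k - 1) +
    h * of_real (q_num q (s * real n + of_int k * (1 - s))) * S_coeff s h q n k"
proof -
  \<comment> \<open>In the last case \<open>b = n - k\<close> is the number of rooks; in the others
    at least one term on the right vanishes by the range convention.\<close>
  consider "k < 0 \<or> k > int (Suc n)" | "k = 0" | "k = int (Suc n)"
    | a b where "k = int (Suc a)" "n = Suc a + b"
  proof -
    assume *: "k < 0 \<or> k > int (Suc n) \<Longrightarrow> thesis" "k = 0 \<Longrightarrow> thesis"
      "k = int (Suc n) \<Longrightarrow> thesis"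
      "\<And>a b. k = int (Suc a) \<Longrightarrow> n = Suc a + b \<Longrightarrow> thesis"
    show thesis
    proof (cases "k > 0 \<and> k \<le> int n")
      case True
      then show thesis by (intro *(4)[of "nat k - 1" "n - nat k"]) auto
    next
      case False
      then have "(k < 0 \<or> k > int (Suc n)) \<or> k = 0 \<or> k = int (Suc n)" by linarith
      then show thesis using *(1-3) by blast
    qed
  qed
  then show ?thesis
  proof cases
    case 1
    then show ?thesis by (auto simp: S_coeff_out_of_range)
  next
    case 2
    then show ?thesis
      by (simp add: S_coeff_rook_sum rook_sum_Suc_Suc[OF assms] rook_sum_eq_0[OF assms]
          algebra_simps)
  next
    case 3
    then show ?thesis
      by (simp add: S_coeff_rook_sum rook_sum_Suc_0[OF assms] algebra_simps)
  next
    case 4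
    have "S_coeff s h q (Suc n) k = rook_sum s h q (Suc n) (Suc b)"
      "S_coeff s h q n (k - 1) = rook_sum s h q n (Suc b)"
      "S_coeff s h q n k = rook_sum s h q n b"
      using 4 by (simp_all add: S_coeff_rook_sum nat_add_distrib)
    moreover have "real n + (s - 1) * real (Suc b) = s * real n + of_int (k - 1) * (1 - s)"
      "real n + (s - 1) * real b = s * real n + of_int k * (1 - s)"
      using 4 by (simp_all add: algebra_simps)
    ultimately show ?thesis
      by (simp only: rook_sum_Suc_Suc[OF assms])
  qed
qed

section \<open>Gaussian coefficients\<close>

lemma gauss_binom_poly_0: "gauss_binom_poly n 0 = 1"
  by (simp add: gauss_binom_poly_def q_fact_poly_nonzero, simp add: q_fact_poly_def)

lemma gauss_binom_poly_self: "gauss_binom_poly n n = 1"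
  by (simp add: gauss_binom_poly_def q_fact_poly_nonzero, simp add: q_fact_poly_def)

text \<open>With \<open>n = r + d + 1\<close>, split
  \<open>[n + 1] = [d + 1] + p^(d + 1) [r + 1]\<close> in the numerator and cancel the common
  factorials. Cancelling in the polynomial ring makes the rule valid at every evaluation point, 1
  included.\<close>

lemma gauss_binom_poly_Suc:
  assumes "r \<le> n"
  shows "gauss_binom_poly (Suc n) (Suc r) =
    gauss_binom_poly n (Suc r) + monom 1 (n - r) * gauss_binom_poly n r"
proof (cases "r = n")
  case True
  then show ?thesis
    by (simp add: gauss_binom_poly_self, simp add: gauss_binom_poly_def monom_0)
next
  case False
  with assms obtain d where n: "n = r + Suc d"
    by (metis less_imp_Suc_add add_Suc_right le_neq_implies_less)
  let ?F = "q_fact_poly" and ?N = "\<lambda>n. \<Sum>j<n. monom (1::real) j"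
  have sum_split: "?N (a + b) = ?N a + monom 1 a * ?N b" for a b
    by (induction b) (simp_all add: mult_monom algebra_simps)
  have "gauss_binom_poly (Suc n) (Suc r) * (?F (Suc r) * ?F (Suc d)) = ?F (Suc n)"
    using gauss_binom_poly_mult[of "Suc r" "Suc n"] n by simp
  also have "\<dots> = ?N (Suc n) * ?F n" by (rule q_fact_poly_Suc)
  also have "\<dots> = ?N (Suc d) * ?F n + monom 1 (Suc d) * ?N (Suc r) * ?F n"
    using sum_split[of "Suc d" "Suc r"] n by (simp add: algebra_simps)
  also have "?N (Suc d) * ?F n = ?N (Suc d) * (gauss_binom_poly n (Suc r) * (?F (Suc r) * ?F d))"
    using gauss_binom_poly_mult[of "Suc r" n] n by simp
  also have "\<dots> = gauss_binom_poly n (Suc r) * (?F (Suc r) * ?F (Suc d))"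
    unfolding q_fact_poly_Suc[of d] by (simp only: ac_simps)
  also have "monom 1 (Suc d) * ?N (Suc r) * ?F n =
      monom 1 (Suc d) * ?N (Suc r) * (gauss_binom_poly n r * (?F r * ?F (Suc d)))"
    using gauss_binom_poly_mult[of r n] n by simp
  also have "\<dots> = monom 1 (n - r) * gauss_binom_poly n r * (?F (Suc r) * ?F (Suc d))"
    unfolding q_fact_poly_Suc[of r] using n by (simp only: ac_simps diff_add_inverse)
  finally have "gauss_binom_poly (Suc n) (Suc r) * (?F (Suc r) * ?F (Suc d)) =
      (gauss_binom_poly n (Suc r) + monom 1 (n - r) * gauss_binom_poly n r) *
      (?F (Suc r) * ?F (Suc d))"
    by (simp only: distrib_right)
  then show ?thesis
    using q_fact_poly_nonzero by simp
qed

lemma gauss_binom_0: "gauss_binom p n 0 = 1"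
  by (simp add: gauss_binom_def gauss_binom_poly_0)

lemma gauss_binom_eq_0: "n < k \<Longrightarrow> gauss_binom p n k = 0"
  by (simp add: gauss_binom_def gauss_binom_poly_def)

lemma gauss_binom_Suc:
  "r \<le> n \<Longrightarrow> gauss_binom p (Suc n) (Suc r) =
     gauss_binom p n (Suc r) + p ^ (n - r) * gauss_binom p n r"
  by (simp add: gauss_binom_def gauss_binom_poly_Suc poly_monom)

section \<open>The convolution\<close>

text \<open>The shift \<open>x\<close> is an arbitrary real, so that the recursion is proved once
  and then used for every \<open>j\<close>.\<close>

definition conv_coeff :: "real \<Rightarrow> complex \<Rightarrow> real \<Rightarrow> real \<Rightarrow> nat \<Rightarrow> nat \<Rightarrow> complex" where
  "conv_coeff s h q x n r =
     h ^ (n - r) * of_real (q powr (real r * x)) * of_real (gauss_binom (q powr s) n r) *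
     of_real (\<Prod>i<n - r. q_num q (x + s * real i))"

lemma conv_coeff_Suc_0:
  assumes "q > 0"
  shows "conv_coeff s h q x (Suc n) 0 =
           conv_coeff s h q x n 0 * h * of_real (q_num q (x + s * real n))"
  using assms by (simp add: conv_coeff_def gauss_binom_0)

text \<open>Pascal's rule at \<open>q powr s\<close>: its factor \<open>(q powr s) ^ (n - r)\<close>
  joins the extra \<open>q powr x\<close> from raising \<open>r\<close>. In the other term the
  product gains its last factor and \<open>h\<close> one power.\<close>

lemma conv_coeff_Suc_Suc:
  assumes "q > 0" "r \<le> n"
  shows "conv_coeff s h q x (Suc n) (Suc r) =
    conv_coeff s h q x n r * of_real (q powr (x + s * real (n - r))) +
    conv_coeff s h q x n (Suc r) * h * of_real (q_num q (x + s * real (n - Suc r)))"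
proof (cases "r = n")
  case True
  \<comment> \<open>Here \<open>n - Suc r\<close> truncates to 0, harmlessly, since
    \<open>conv_coeff s h q x n (Suc n)\<close> is 0.\<close>
  have "q powr (real (Suc n) * x) = q powr (real n * x) * q powr x"
    by (simp add: distrib_right powr_add)
  then show ?thesis
    using gauss_binom_Suc[of n n "q powr s"] True
    by (simp add: conv_coeff_def gauss_binom_eq_0 del: of_nat_Suc)
next
  case False
  then obtain d where n: "n = r + Suc d"
    using assms(2) by (metis less_imp_Suc_add add_Suc_right le_neq_implies_less)
  have pw: "(q powr s) ^ Suc d = q powr (s * real (Suc d))"
    using assms(1) by (simp only: powr_powr[symmetric]) (subst powr_realpow; simp)
  have x: "q powr (real r * x) * q powr (x + s * real (Suc d)) =
      q powr (real (Suc r) * x) * q powr (s * real (Suc d))"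
    by (simp add: powr_add[symmetric] algebra_simps)
  let ?P = "\<Prod>i<d. q_num q (x + s * real i)" and ?Q = "q_num q (x + s * real d)"
  have "conv_coeff s h q x (Suc n) (Suc r) =
      h ^ Suc d * of_real (q powr (real (Suc r) * x) *
        (gauss_binom (q powr s) n (Suc r) + q powr (s * real (Suc d)) * gauss_binom (q powr s) n r) *
        (?P * ?Q))"
    using gauss_binom_Suc[OF assms(2), of "q powr s"] pw n
    by (simp add: conv_coeff_def mult.assoc del: power_Suc of_nat_Suc)
  also have "\<dots> = h ^ Suc d * of_real ((q powr (real (Suc r) * x) * q powr (s * real (Suc d))) *
        gauss_binom (q powr s) n r * (?P * ?Q)) +
      h ^ Suc d * of_real (q powr (real (Suc r) * x) * gauss_binom (q powr s) n (Suc r) * (?P * ?Q))"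
    unfolding distrib_left[symmetric] of_real_add[symmetric]
    by (simp add: algebra_simps)
  finally show ?thesis
    unfolding x[symmetric] conv_coeff_def using n
    by (simp add: ac_simps del: of_nat_Suc)
qed

text \<open>This is the recurrence \<open>S_coeff_Suc\<close> with both exponents increased by
  \<open>x\<close>.\<close>

lemma sum_conv_coeff_Suc:
  assumes "q > 0"
  shows "(\<Sum>r\<le>Suc n. conv_coeff s h q x (Suc n) r * S_coeff s h q r l) =
    of_real (q powr (x + s * real n + of_int (l - 1) * (1 - s))) *
      (\<Sum>r\<le>n. conv_coeff s h q x n r * S_coeff s h q r (l - 1)) +
    h * of_real (q_num q (x + s * real n + of_int l * (1 - s))) *
      (\<Sum>r\<le>n. conv_coeff s h q x n r * S_coeff s h q r l)"
proof -
  let ?c = "conv_coeff s h q x" and ?S = "S_coeff s h q"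
  \<comment> \<open>Splitting the exponent turns the two-term step into one step of the recurrence for \<open>S\<close>
    at \<open>r\<close>, so that only the index of \<open>S\<close> has to be shifted.\<close>
  let ?w = "\<lambda>r. of_real (q powr (x + s * real (n - r))) :: complex"
  let ?b = "\<lambda>r. h * of_real (q_num q (x + s * real (n - r)))"
  have step: "of_real (q powr (x + s * real n + of_int (l - 1) * (1 - s))) * ?S r (l - 1) +
      h * of_real (q_num q (x + s * real n + of_int l * (1 - s))) * ?S r l =
      ?w r * ?S (Suc r) l + ?b r * ?S r l" if "r \<le> n" for r
  proof -
    have 1: "x + s * real n + y = (x + s * real (n - r)) + (s * real r + y)" for y
      using that by (simp add: of_nat_diff algebra_simps)
    show ?thesis
      unfolding 1 q_num_add[OF assms] S_coeff_Suc[OF assms] powr_add[of q "x + s * real (n - r)"]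
      by (simp add: algebra_simps)
  qed
  have "(\<Sum>r\<le>Suc n. ?c (Suc n) r * ?S r l) =
      ?c (Suc n) 0 * ?S 0 l + (\<Sum>r\<le>n. ?c (Suc n) (Suc r) * ?S (Suc r) l)"
    by (rule sum.atMost_Suc_shift)
  also have "(\<Sum>r\<le>n. ?c (Suc n) (Suc r) * ?S (Suc r) l) =
      (\<Sum>r\<le>n. ?c n r * ?w r * ?S (Suc r) l) + (\<Sum>r\<le>n. ?c n (Suc r) * ?b (Suc r) * ?S (Suc r) l)"
    unfolding sum.distrib[symmetric]
    by (intro sum.cong) (simp_all add: conv_coeff_Suc_Suc[OF assms] algebra_simps)
  also have "?c (Suc n) 0 * ?S 0 l = ?c n 0 * ?b 0 * ?S 0 l"
    by (simp add: conv_coeff_Suc_0[OF assms])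
  finally have "(\<Sum>r\<le>Suc n. ?c (Suc n) r * ?S r l) =
      (\<Sum>r\<le>n. ?c n r * ?w r * ?S (Suc r) l) +
      (?c n 0 * ?b 0 * ?S 0 l + (\<Sum>r\<le>n. ?c n (Suc r) * ?b (Suc r) * ?S (Suc r) l))"
    by simp
  also have "?c n 0 * ?b 0 * ?S 0 l + (\<Sum>r\<le>n. ?c n (Suc r) * ?b (Suc r) * ?S (Suc r) l) =
      (\<Sum>r\<le>Suc n. ?c n r * ?b r * ?S r l)"
    by (rule sum.atMost_Suc_shift[symmetric])
  \<comment> \<open>The top term \<open>r = n + 1\<close> carries a vanishing Gaussian
    coefficient.\<close>
  also have "\<dots> = (\<Sum>r\<le>n. ?c n r * ?b r * ?S r l)"
    by (simp add: conv_coeff_def gauss_binom_eq_0)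
  also have "(\<Sum>r\<le>n. ?c n r * ?w r * ?S (Suc r) l) + (\<Sum>r\<le>n. ?c n r * ?b r * ?S r l) =
      (\<Sum>r\<le>n. ?c n r * (?w r * ?S (Suc r) l + ?b r * ?S r l))"
    by (simp only: sum.distrib[symmetric] distrib_left mult.assoc)
  also have "\<dots> = (\<Sum>r\<le>n. ?c n r *
      (of_real (q powr (x + s * real n + of_int (l - 1) * (1 - s))) * ?S r (l - 1) +
       h * of_real (q_num q (x + s * real n + of_int l * (1 - s))) * ?S r l))"
    by (intro sum.cong) (simp_all only: step atMost_iff)
  finally show ?thesis
    by (simp only: sum_distrib_left sum.distrib[symmetric] distrib_left ac_simps)
qed

text \<open>Both sides obey the same recurrence in \<open>n\<close>; at \<open>n = 0\<close> the
  inner sum is 1 for \<open>k = j\<close> and 0 otherwise.\<close>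

lemma S_coeff_convolution:
  assumes "q > 0"
  shows "S_coeff s h q (n + m) k =
    (\<Sum>j\<le>m. S_coeff s h q m (int j) *
      (\<Sum>r\<le>n. conv_coeff s h q (real j * (1 - s) + s * real m) n r * S_coeff s h q r (k - int j)))"
proof (induction n arbitrary: k)
  case 0
  have "S_coeff s h q m k = (\<Sum>j\<le>m. S_coeff s h q m (int j) * (if k = int j then 1 else 0))"
  proof (cases "0 \<le> k \<and> k \<le> int m")
    case True
    then obtain i where i: "k = int i" "i \<le> m" by (metis nonneg_int_cases of_nat_le_iff)
    have "(\<Sum>j\<le>m. S_coeff s h q m (int j) * (if k = int j then 1 else 0)) =
        (\<Sum>j\<le>m. if i = j then S_coeff s h q m (int j) else 0)"
      by (intro sum.cong) (auto simp: i)
    then show ?thesis using i by simp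
  next
    case False
    then show ?thesis
      by (subst sum.neutral) (auto simp: S_coeff_out_of_range)
  qed
  then show ?case
    using assms by (simp add: conv_coeff_def gauss_binom_0 S_coeff_0_left)
next
  case (Suc n)
  let ?x = "\<lambda>j. real j * (1 - s) + s * real m"
  let ?T = "\<lambda>n j l. \<Sum>r\<le>n. conv_coeff s h q (?x j) n r * S_coeff s h q r l"
  let ?A = "of_real (q powr (s * real (n + m) + of_int (k - 1) * (1 - s))) :: complex"
  let ?B = "h * of_real (q_num q (s * real (n + m) + of_int k * (1 - s)))"
  \<comment> \<open>The terms \<open>j (1 - s)\<close> in the shift and in the index
    \<open>k - j\<close> cancel, so \<open>?A\<close> and \<open>?B\<close> are the same for all
    \<open>j\<close> and factor out of the sum.\<close>
  have T: "?T (Suc n) j (k - int j) = ?A * ?T n j (k - 1 - int j) + ?B * ?T n j (k - int j)" for j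
  proof -
    have "?x j + s * real n + of_int (k - int j - 1) * (1 - s) =
        s * real (n + m) + of_int (k - 1) * (1 - s)"
      "?x j + s * real n + of_int (k - int j) * (1 - s) = s * real (n + m) + of_int k * (1 - s)"
      by (simp_all add: algebra_simps)
    moreover have "k - int j - 1 = k - 1 - int j" by simp
    ultimately show ?thesis using sum_conv_coeff_Suc[OF assms, of s h "?x j" n "k - int j"]
      by (simp only:)
  qed
  have lin: "a * (\<Sum>j\<le>m. f j * u j) + b * (\<Sum>j\<le>m. f j * v j) = (\<Sum>j\<le>m. f j * (a * u j + b * v j))"
    for a b :: complex and f u v
    by (simp add: sum_distrib_left sum.distrib algebra_simps)
  have "S_coeff s h q (Suc n + m) k = ?A * S_coeff s h q (n + m) (k - 1) + ?B * S_coeff s h q (n + m) k"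
    using S_coeff_Suc[OF assms, of s h "n + m" k] by simp
  also have "\<dots> = (\<Sum>j\<le>m. S_coeff s h q m (int j) *
      (?A * ?T n j (k - 1 - int j) + ?B * ?T n j (k - int j)))"
    unfolding Suc.IH by (rule lin)
  finally show ?case by (simp only: T)
qed

section \<open>The convolution identities and their specialisation to \<open>m = 1\<close>\<close>

lemma S_coeff_add:
  assumes "q > 0"
  shows "S_coeff s h q (n + m) k =
    (\<Sum>r = 0..n. \<Sum>j = 0..m.
       h ^ (n - r) * of_real (q powr (real r * (real j * (1 - s) + s * real m))) *
       of_real (gauss_binom (q powr s) n r) *
       S_coeff s h q m (int j) * S_coeff s h q r (k - int j) *
       of_real (\<Prod>i<n - r. q_num q (real j * (1 - s) + s * real m + s * real i)))"
  unfolding S_coeff_convolution[OF assms] atMost_atLeast0 sum_distrib_left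
  by (subst sum.swap) (simp add: conv_coeff_def ac_simps)

lemma B_coeff_eq_sum:
  assumes "j + r \<le> N"
  shows "(\<Sum>k = 0..N. S_coeff s h q r (int k - int j)) = B_coeff s h q r"
proof -
  have "(\<Sum>k = 0..N. S_coeff s h q r (int k - int j)) =
      (\<Sum>k = j..j + r. S_coeff s h q r (int k - int j))"
    \<comment> \<open>The support \<open>j..j + r\<close> of the shifted sequence lies within
      \<open>0..N\<close>.\<close>
    using assms by (intro sum.mono_neutral_right) (auto simp: S_coeff_out_of_range)
  also have "\<dots> = (\<Sum>k = 0..r. S_coeff s h q r (int k))"
    by (rule sum.reindex_bij_witness[of _ "\<lambda>k. k + j" "\<lambda>k. k - j"]) (auto simp: of_nat_diff)
  finally show ?thesis by (simp add: B_coeff_def)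
qed

lemma B_coeff_add:
  assumes "q > 0"
  shows "B_coeff s h q (n + m) =
    (\<Sum>r = 0..n. \<Sum>j = 0..m.
       h ^ (n - r) * of_real (q powr (real r * (real j * (1 - s) + s * real m))) *
       of_real (gauss_binom (q powr s) n r) *
       S_coeff s h q m (int j) * B_coeff s h q r *
       of_real (\<Prod>i<n - r. q_num q (real j * (1 - s) + s * real m + s * real i)))"
proof -
  \<comment> \<open>\<open>C\<close> and \<open>D\<close> bundle the factors independent of
    \<open>k\<close>, so that the sum over \<open>k\<close> moves innermost and acts on one
    factor.\<close>
  define C where "C r j = h ^ (n - r) *
    of_real (q powr (real r * (real j * (1 - s) + s * real m))) *
    of_real (gauss_binom (q powr s) n r) * S_coeff s h q m (int j)" for r j
  define D where "D r j = (of_real (\<Prod>i<n - r.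
    q_num q (real j * (1 - s) + s * real m + s * real i)) :: complex)" for r j
  have "B_coeff s h q (n + m) =
      (\<Sum>k = 0..n + m. \<Sum>r = 0..n. \<Sum>j = 0..m. C r j * S_coeff s h q r (int k - int j) * D r j)"
    unfolding B_coeff_def[of s h q "n + m"] S_coeff_add[OF assms] C_def D_def ..
  also have "\<dots> = (\<Sum>r = 0..n. \<Sum>j = 0..m. \<Sum>k = 0..n + m.
      C r j * S_coeff s h q r (int k - int j) * D r j)"
    by (subst sum.swap) (intro sum.cong refl sum.swap)
  also have "\<dots> = (\<Sum>r = 0..n. \<Sum>j = 0..m. C r j * B_coeff s h q r * D r j)"
    unfolding sum_distrib_left[symmetric] sum_distrib_right[symmetric]
    by (intro sum.cong refl) (simp add: B_coeff_eq_sum)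
  finally show ?thesis unfolding C_def D_def .
qed

text \<open>For \<open>m = 1\<close> only \<open>j = 1\<close> survives in the convolution, and the
  shift becomes \<open>(1 - s) + s = 1\<close>.\<close>

lemma S_coeff_1: "q > 0 \<Longrightarrow> S_coeff s h q (Suc 0) k = (if k = 1 then 1 else 0)"
  by (simp add: S_coeff_Suc S_coeff_0_left q_num_0)

theorem mainTheorem20:
  fixes s q :: real and h :: complex
  assumes "h \<noteq> 0" and "q > 0"
  shows "(\<forall>n k :: nat. n \<ge> 1 \<longrightarrow> k \<ge> 1 \<longrightarrow>
            S_coeff s h q n (int k) =
              (\<Sum>r = k - 1..n - 1.
                 h ^ (n - r - 1) * of_real (q ^ r) *
                 of_real (gauss_binom (q powr s) (n - 1) r) *
                 S_coeff s h q r (int k - 1) *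
                 of_real (\<Prod>i<n - r - 1. q_num q (1 + s * real i))))
       \<and> (\<forall>n :: nat. n \<ge> 1 \<longrightarrow>
            B_coeff s h q n =
              (\<Sum>r = 0..n - 1.
                 h ^ (n - r - 1) * of_real (q ^ r) *
                 of_real (gauss_binom (q powr s) (n - 1) r) *
                 B_coeff s h q r *
                 of_real (\<Prod>i<n - r - 1. q_num q (1 + s * real i))))
       \<and> (\<forall>n m k :: nat.
            S_coeff s h q (n + m) (int k) =
              (\<Sum>r = 0..n. \<Sum>j = 0..m.
                 h ^ (n - r) * of_real (q powr (real r * (real j * (1 - s) + s * real m))) *
                 of_real (gauss_binom (q powr s) n r) *
                 S_coeff s h q m (int j) * S_coeff s h q r (int k - int j) *
                 of_real (\<Prod>i<n - r. q_num q (real j * (1 - s) + s * real m + s * real i))))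
       \<and> (\<forall>n m :: nat.
            B_coeff s h q (n + m) =
              (\<Sum>r = 0..n. \<Sum>j = 0..m.
                 h ^ (n - r) * of_real (q powr (real r * (real j * (1 - s) + s * real m))) *
                 of_real (gauss_binom (q powr s) n r) *
                 S_coeff s h q m (int j) * B_coeff s h q r *
                 of_real (\<Prod>i<n - r. q_num q (real j * (1 - s) + s * real m + s * real i))))"
proof (intro conjI allI impI)
  fix n k :: nat
  assume n: "n \<ge> 1" and k: "k \<ge> 1"
  let ?t = "\<lambda>r. h ^ (n - r - 1) * of_real (q ^ r) * of_real (gauss_binom (q powr s) (n - 1) r) *
    S_coeff s h q r (int k - 1) * of_real (\<Prod>i<n - r - 1. q_num q (1 + s * real i))"
  have "S_coeff s h q n (int k) = (\<Sum>r = 0..n - 1. ?t r)"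
    using S_coeff_add[OF assms(2), of s h "n - 1" 1 "int k"] n assms(2)
    by (simp add: S_coeff_1 powr_realpow)
  \<comment> \<open>Terms with \<open>r < k - 1\<close> vanish by the range convention; for
    \<open>k > n\<close> all of them do and the range is empty.\<close>
  also have "\<dots> = (\<Sum>r = k - 1..n - 1. ?t r)"
    using k by (intro sum.mono_neutral_right) (auto simp: S_coeff_out_of_range)
  finally show "S_coeff s h q n (int k) = (\<Sum>r = k - 1..n - 1. ?t r)" .
next
  fix n :: nat
  assume "n \<ge> 1"
  then show "B_coeff s h q n = (\<Sum>r = 0..n - 1. h ^ (n - r - 1) * of_real (q ^ r) *
      of_real (gauss_binom (q powr s) (n - 1) r) * B_coeff s h q r *
      of_real (\<Prod>i<n - r - 1. q_num q (1 + s * real i)))"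
    using B_coeff_add[OF assms(2), of s h "n - 1" 1] assms(2)
    by (simp add: S_coeff_1 powr_realpow)
qed (fact S_coeff_add[OF assms(2)] B_coeff_add[OF assms(2)])+

end
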